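(* Let $0<p<\frac12$ and define, on the open unit disk $\mathbb{D}$, $$f(z)=(1+z)^{4/p},\qquad g(z)=-f(-z)=-(1-z)^{4/p},$$ where the powers are defined by the branch of the complex logarithm with $\log 1=0$. Then the functions $f$ and $g$ both belong to the Bergman space $A^p$ but fail to satisfy the triangle inequality for $\|\cdot\|_{A^p}$; that is, $\|f+g\|_{A^p}>\|f\|_{A^p}+\|g\|_{A^p}$.
   Context: $\mathbb{D}=\{z\in\mathbb{C}:|z|<1\}$, and $dA(z)=\frac{dx\,dy}{\pi}$ ($z=x+iy$) is the normalized Lebesgue area measure on $\mathbb{D}$. For $0<p<\infty$ and $f$ analytic in $\mathbb{D}$, $\|f\|_{A^p}=\left(\int_{\mathbb{D}}|f(z)|^p\,dA(z)\right)^{1/p}$; the Bergman space $A^p$ is the set of all $f$ analytic in $\mathbb{D}$ with $\|f\|_{A^p}<\infty$. The notation $\|\cdot\|_{A^p}$ is used also for $0<p<1$, although it need not be a norm. Powers are $(1\pm z)^{s}=\exp(s\log(1\pm z))$. *)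

theory Defs
  imports "HOL-Complex_Analysis.Complex_Analysis"
begin

definition disk_area :: "complex measure" where
  "disk_area = scale_measure (ennreal (1 / pi)) (restrict_space lborel (ball 0 1))"

text \<open>The library has no real powers on \<^typ>\<open>ennreal\<close>; the infinite case, where the
  \<open>1/p\<close>-th power is again infinite, is therefore separated.\<close>

definition bergman_norm :: "real \<Rightarrow> (complex \<Rightarrow> complex) \<Rightarrow> ennreal" where
  "bergman_norm p f =
     (let I = (\<integral>\<^sup>+ z. ennreal (cmod (f z) powr p) \<partial>disk_area)
      in if I = \<infinity> then \<infinity> else ennreal (enn2real I powr (1 / p)))"

text \<open>Functions are total on \<^typ>\<open>complex\<close>, but only their values on the unit disk matter.\<close>

definition bergman_space :: "real \<Rightarrow> (complex \<Rightarrow> complex) set" where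
  "bergman_space p = {f. f holomorphic_on ball 0 1 \<and> bergman_norm p f < \<infinity>}"

end

theory Submission
  imports Defs
begin

text \<open>
  Raised to the power \<open>p\<close>, the modulus of \<open>f\<close> no longer depends on \<open>p\<close>: it is \<open>|1 + z|\<^sup>4\<close>.
  The average of \<open>|1 + z|\<^sup>4\<close> over the four quarter turns of \<open>z\<close> is \<open>1 + 4 |z|\<^sup>2 + |z|\<^sup>4\<close>, and
  \<open>|z|\<^sup>2\<close> is uniformly distributed on \<open>[0, 1]\<close> under the normalized area measure
  (\<open>distr_disk_area_square_modulus\<close>), so its integral is \<open>1 + 2 + 1/3 = 10/3\<close>
  (\<open>nn_integral_fourth_power_one_plus\<close>). Hence \<open>f\<close>, and likewise \<open>g\<close>, has Bergman norm
  \<open>(10/3)\<^bsup>1/p\<^esup>\<close>, and the claim amounts to \<open>\<integral> |f + g|\<^sup>p dA > 2\<^sup>p \<cdot> 10/3\<close>.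

  For the lower bound, \<open>t \<mapsto> t\<^sup>p\<close> is subadditive since \<open>p \<le> 1\<close>, so that
  \<open>|f(z) + g(z)|\<^sup>p \<ge> | |f(z)|\<^sup>p - |g(z)|\<^sup>p | = | |1 + z|\<^sup>4 - |1 - z|\<^sup>4 | = 8 |Re z| (1 + |z|\<^sup>2)\<close>.
  The last function does not involve \<open>p\<close> either, and slicing the disk horizontally shows that its
  integral is \<open>256 / (15 \<pi>)\<close> (\<open>nn_integral_abs_Re\<close>). This exceeds \<open>5\<close>, whereas
  \<open>2\<^sup>p \<cdot> 10/3 < \<surd>2 \<cdot> 10/3 < 5\<close> for \<open>p < 1/2\<close>.
\<close>

section \<open>Elementary estimates for moduli and real powers\<close>

text \<open>The power \<open>t\<^sup>p\<close> lies above its chord on \<open>[0, x + y]\<close>; adding the chord values at \<open>x\<close> and \<open>y\<close>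
  gives the value at \<open>x + y\<close>.\<close>

lemma powr_add_le:
  fixes x y p :: real
  assumes "0 \<le> x" "0 \<le> y" "0 < p" "p \<le> 1"
  shows "(x + y) powr p \<le> x powr p + y powr p"
proof (cases "x + y = 0")
  case False
  define s where "s = x + y"
  have s: "0 < s" using False assms by (simp add: s_def)
  have *: "t / s * s powr p \<le> t powr p" if "0 \<le> t" "t \<le> s" for t
  proof -
    have "(t / s) powr 1 \<le> (t / s) powr p"
      using that s assms by (intro powr_mono') auto
    then show ?thesis using that s by (simp add: powr_divide field_simps)
  qed
  have "x / s * s powr p + y / s * s powr p \<le> x powr p + y powr p"
    using assms by (intro add_mono *) (auto simp: s_def)
  moreover have "x / s * s powr p + y / s * s powr p = s powr p"
    using s by (simp add: s_def flip: distrib_right add_divide_distrib)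
  ultimately show ?thesis by (simp add: s_def)
qed (use assms in simp)

lemma norm_powr_diff_le:
  fixes a b :: "'a :: real_normed_vector" and p :: real
  assumes "0 < p" "p \<le> 1"
  shows "\<bar>norm a powr p - norm b powr p\<bar> \<le> norm (a - b) powr p"
proof -
  have *: "norm u powr p \<le> norm (u - v) powr p + norm v powr p" for u v :: 'a
  proof -
    have "norm u powr p \<le> (norm (u - v) + norm v) powr p"
      using norm_triangle_ineq [of "u - v" v] assms by (intro powr_mono2) auto
    also have "\<dots> \<le> norm (u - v) powr p + norm v powr p"
      using assms by (intro powr_add_le) auto
    finally show ?thesis .
  qed
  show ?thesis
    using * [of a b] * [of b a] by (simp add: norm_minus_commute)
qed

lemma cmod_powr_powr:
  assumes "0 < p"
  shows "cmod (w powr complex_of_real (n / p)) powr p = cmod w powr n"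
  using assms by (simp add: norm_powr_real_powr' powr_powr)

lemma cmod_power4: "cmod w ^ 4 = ((Re w)\<^sup>2 + (Im w)\<^sup>2)\<^sup>2"
  by (simp flip: cmod_power2)

lemma fourth_power_difference:
  "cmod (1 + z) ^ 4 - cmod (1 - z) ^ 4 = 8 * (Re z * (1 + (cmod z)\<^sup>2))"
  unfolding cmod_power4 cmod_power2 by (simp add: algebra_simps power2_eq_square)

section \<open>Lebesgue measure on the complex plane\<close>

lemma lborel_complex_eq_distr:
  "(lborel :: complex measure) = distr (lborel \<Otimes>\<^sub>M lborel) borel (\<lambda>(x, y). Complex x y)"
proof (rule lborel_eqI)
  have m [measurable]: "(\<lambda>(x, y). Complex x y) \<in> borel_measurable (lborel \<Otimes>\<^sub>M lborel)"
    by (simp add: borel_measurable_complex_iff split_beta)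
  fix l u :: complex
  assume le: "\<And>b. b \<in> Basis \<Longrightarrow> l \<bullet> b \<le> u \<bullet> b"
  have lu: "Re l \<le> Re u" "Im l \<le> Im u"
    using le [of 1] le [of "\<i>"] by (simp_all add: Basis_complex_def)
  have "(\<lambda>(x, y). Complex x y) -` box l u = {Re l<..<Re u} \<times> {Im l<..<Im u}"
    by (auto simp: box_def Basis_complex_def)
  then show "emeasure (distr (lborel \<Otimes>\<^sub>M lborel) borel (\<lambda>(x, y). Complex x y)) (box l u)
      = (\<Prod>b\<in>Basis. (u - l) \<bullet> b)"
    using lu m
    by (simp add: emeasure_distr space_pair_measure lborel.emeasure_pair_measure_Times
        Basis_complex_def ennreal_mult)
qed simp

lemma nn_integral_lborel_complex:
  assumes [measurable]: "F \<in> borel_measurable borel"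
  shows "(\<integral>\<^sup>+ z. F z \<partial>lborel) = (\<integral>\<^sup>+ y. \<integral>\<^sup>+ x. F (Complex x y) \<partial>lborel \<partial>lborel)"
proof -
  have [measurable]: "(\<lambda>(x, y). Complex x y) \<in> borel_measurable (lborel \<Otimes>\<^sub>M lborel)"
    by (simp add: borel_measurable_complex_iff split_beta)
  have "(\<integral>\<^sup>+ z. F z \<partial>lborel) = (\<integral>\<^sup>+ (x, y). F (Complex x y) \<partial>(lborel \<Otimes>\<^sub>M lborel))"
    by (subst lborel_complex_eq_distr, subst nn_integral_distr) (auto simp: case_prod_beta')
  also have "\<dots> = (\<integral>\<^sup>+ y. \<integral>\<^sup>+ x. F (Complex x y) \<partial>lborel \<partial>lborel)"
    by (subst lborel_pair.nn_integral_snd [symmetric]) (auto simp: split_beta)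
  finally show ?thesis .
qed

lemma distr_lborel_quarter_turn:
  "distr lborel borel (\<lambda>z. \<i> * z) = lborel"
proof (rule sym, rule lborel_eqI)
  fix l u :: complex
  assume le: "\<And>b. b \<in> Basis \<Longrightarrow> l \<bullet> b \<le> u \<bullet> b"
  have lu: "Re l \<le> Re u" "Im l \<le> Im u"
    using le [of 1] le [of "\<i>"] by (simp_all add: Basis_complex_def)
  have "(\<lambda>z. \<i> * z) -` box l u = box (Complex (Im l) (- Re u)) (Complex (Im u) (- Re l))"
    by (auto simp: box_def Basis_complex_def)
  then show "emeasure (distr lborel borel (\<lambda>z. \<i> * z)) (box l u) = (\<Prod>b\<in>Basis. (u - l) \<bullet> b)"
    using lu by (simp add: emeasure_distr emeasure_lborel_box_eq Basis_complex_def mult.commute)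
qed simp

section \<open>Normalized area measure on the unit disk\<close>

lemma sets_disk_area: "sets disk_area = sets (restrict_space borel (ball 0 1))"
  by (simp add: disk_area_def sets_restrict_space)

lemma borel_measurable_disk_area:
  "F \<in> borel_measurable borel \<Longrightarrow> F \<in> borel_measurable disk_area"
  by (simp add: measurable_cong_sets[OF sets_disk_area refl] measurable_restrict_space1)

lemma space_disk_area: "space disk_area = ball 0 1"
  by (simp add: disk_area_def space_scale_measure space_restrict_space)

lemma nn_integral_disk_area:
  assumes [measurable]: "F \<in> borel_measurable borel"
  shows "(\<integral>\<^sup>+ z. F z \<partial>disk_area)
    = ennreal (1 / pi) * (\<integral>\<^sup>+ z. F z * indicator (ball 0 1) z \<partial>lborel)"
proof -
  have "F \<in> borel_measurable (restrict_space lborel (ball 0 1))"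
    by (intro measurable_restrict_space1) simp
  then show ?thesis
    unfolding disk_area_def
    by (simp only: nn_integral_scale_measure) (subst nn_integral_restrict_space; simp)
qed

lemma nn_integral_disk_area_quarter_turn:
  assumes [measurable]: "F \<in> borel_measurable borel"
  shows "(\<integral>\<^sup>+ z. F (\<i> * z) \<partial>disk_area) = (\<integral>\<^sup>+ z. F z \<partial>disk_area)"
proof -
  have meas: "(\<lambda>z. F (\<i> * z)) \<in> borel_measurable borel"
    by measurable
  have "(\<integral>\<^sup>+ z. F z * indicator (ball 0 1) z \<partial>lborel)
      = (\<integral>\<^sup>+ z. F z * indicator (ball 0 1) z \<partial>(distr lborel borel (\<lambda>z. \<i> * z)))"
    by (simp only: distr_lborel_quarter_turn)
  also have "\<dots> = (\<integral>\<^sup>+ z. F (\<i> * z) * indicator (ball 0 1) (\<i> * z) \<partial>lborel)"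
    by (rule nn_integral_distr) (auto intro!: borel_measurable_times_ennreal borel_measurable_indicator)
  also have "\<dots> = (\<integral>\<^sup>+ z. F (\<i> * z) * indicator (ball 0 1) z \<partial>lborel)"
    by (intro nn_integral_cong) (simp add: indicator_def norm_mult)
  finally show ?thesis
    by (simp only: nn_integral_disk_area assms nn_integral_disk_area [of "\<lambda>z. F (\<i> * z)"] meas)
qed

text \<open>The area grows with the square of the radius, which is why \<open>|z|\<^sup>2\<close>, and not \<open>|z|\<close>, has a uniform
  distribution; this replaces polar coordinates in the integration of radial functions.\<close>

lemma emeasure_disk_area_annulus:
  fixes t :: real
  assumes "0 \<le> t" "t \<le> 1"
  shows "emeasure disk_area {z \<in> ball 0 1. t < (cmod z)\<^sup>2} = ennreal (1 - t)"
proof -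
  have iff: "t < (cmod z)\<^sup>2 \<longleftrightarrow> sqrt t < cmod z" for z
    using assms by (metis abs_norm_cancel real_sqrt_abs real_sqrt_less_iff)
  have eq: "{z \<in> ball 0 1. t < (cmod z)\<^sup>2} = ball 0 1 - cball 0 (sqrt t)"
    unfolding iff by auto
  have "emeasure lborel (ball 0 1 - cball (0 :: complex) (sqrt t))
      = emeasure lborel (ball (0 :: complex) 1 - ball 0 (sqrt t) - sphere 0 (sqrt t))"
    by (intro arg_cong [where f = "emeasure lborel"]) auto
  also have "\<dots> = emeasure lborel (ball (0 :: complex) 1 - ball 0 (sqrt t))"
  proof (rule emeasure_Diff_null_set)
    have "negligible (sphere (0 :: complex) (sqrt t))" by (rule negligible_sphere)
    then show "sphere (0 :: complex) (sqrt t) \<in> null_sets lborel"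
      by (simp add: null_sets_completion_iff negligible_iff_null_sets)
  qed auto
  also have "\<dots> = ennreal pi - ennreal (pi * t)"
    using assms by (subst emeasure_Diff) (auto simp: emeasure_ball unit_ball_vol_2 subset_ball)
  also have "\<dots> = ennreal (pi - pi * t)"
    using assms by (intro ennreal_minus) auto
  finally have *: "emeasure lborel (ball 0 1 - cball (0 :: complex) (sqrt t)) = ennreal (pi - pi * t)" .
  have "emeasure disk_area {z \<in> ball 0 1. t < (cmod z)\<^sup>2}
      = ennreal (1 / pi) * ennreal (pi - pi * t)"
    unfolding disk_area_def eq by (simp add: emeasure_restrict_space *)
  also have "\<dots> = ennreal (1 - t)"
    using assms by (subst ennreal_mult [symmetric]) (auto simp: field_simps)
  finally show ?thesis .
qed

lemma distr_disk_area_square_modulus: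
  "distr disk_area borel (\<lambda>z. (cmod z)\<^sup>2) = density lborel (indicator {0..1})"
proof -
  have eq: "emeasure (distr disk_area borel (\<lambda>z. (cmod z)\<^sup>2)) {t<..}
      = ennreal (1 - min 1 (max 0 t))" for t
  proof -
    have "emeasure (distr disk_area borel (\<lambda>z. (cmod z)\<^sup>2)) {t<..}
        = emeasure disk_area {z \<in> ball 0 1. t < (cmod z)\<^sup>2}"
      by (subst emeasure_distr)
         (auto simp: space_disk_area intro!: borel_measurable_disk_area arg_cong [where f = "emeasure disk_area"])
    also have "\<dots> = ennreal (1 - min 1 (max 0 t))"
    proof (cases "t < 0")
      case True
      have "{z. cmod z < 1 \<and> t < (cmod z)\<^sup>2} = {z. cmod z < 1}"
        using True by (auto intro: less_le_trans)
      moreover have "emeasure disk_area (ball 0 1) = 1"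
        by (simp add: disk_area_def emeasure_restrict_space emeasure_ball unit_ball_vol_2
            flip: ennreal_mult)
      moreover have "ball (0 :: complex) 1 = {z. cmod z < 1}"
        by auto
      ultimately show ?thesis using True by simp
    next
      case False
      show ?thesis
      proof (cases "t \<le> 1")
        case True
        then show ?thesis using False emeasure_disk_area_annulus [of t] by simp
      next
        case t: False
        have "{z \<in> ball (0 :: complex) 1. t < (cmod z)\<^sup>2} = {}"
          using t abs_square_less_1 [of "cmod z" for z] by (force simp: not_less)
        then show ?thesis using t by (simp only:) simp
      qed
    qed
    finally show ?thesis .
  qed
  have split: "{0..1} \<inter> {t<..} = (if t < 0 then {0..1} else {t<..1})" for t :: real
    by auto
  have eq': "emeasure (density lborel (indicator {0..1})) {t<..}
      = ennreal (1 - min 1 (max 0 t))" for t :: real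
    by (cases "t \<le> 1") (auto simp: emeasure_density split simp flip: indicator_inter_arith)
  show ?thesis
    by (rule measure_eqI_lessThan) (auto simp: eq eq')
qed

lemma nn_integral_disk_area_radial:
  assumes [measurable]: "\<phi> \<in> borel_measurable borel"
  shows "(\<integral>\<^sup>+ z. \<phi> ((cmod z)\<^sup>2) \<partial>disk_area) = (\<integral>\<^sup>+ t. \<phi> t * indicator {0..1} t \<partial>lborel)"
proof -
  have "(\<integral>\<^sup>+ z. \<phi> ((cmod z)\<^sup>2) \<partial>disk_area) = (\<integral>\<^sup>+ t. \<phi> t \<partial>(distr disk_area borel (\<lambda>z. (cmod z)\<^sup>2)))"
    by (subst nn_integral_distr) (auto intro!: borel_measurable_disk_area)
  then show ?thesis
    by (simp add: distr_disk_area_square_modulus nn_integral_density mult.commute)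
qed

section \<open>The two integrals\<close>

text \<open>Summing over the quarter turns of \<open>z\<close> cancels every term that is not radial, and each turn
  contributes the same integral.\<close>

lemma nn_integral_fourth_power_one_plus:
  "(\<integral>\<^sup>+ z. ennreal (cmod (1 + z) ^ 4) \<partial>disk_area) = ennreal (10 / 3)"
    (is "?I = _")
proof -
  define G where "G z = ennreal (cmod (1 + z) ^ 4)" for z
  have [measurable]: "G \<in> borel_measurable borel" "(\<lambda>z. G (\<i> * z)) \<in> borel_measurable borel"
      "(\<lambda>z. G (\<i> * (\<i> * z))) \<in> borel_measurable borel"
      "(\<lambda>z. G (\<i> * (\<i> * (\<i> * z)))) \<in> borel_measurable borel"
    unfolding G_def by measurable
  note meas = this [THEN borel_measurable_disk_area]
  have turns: "(\<integral>\<^sup>+ z. G z \<partial>disk_area) = ?I" "(\<integral>\<^sup>+ z. G (\<i> * z) \<partial>disk_area) = ?I"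
    "(\<integral>\<^sup>+ z. G (\<i> * (\<i> * z)) \<partial>disk_area) = ?I"
    "(\<integral>\<^sup>+ z. G (\<i> * (\<i> * (\<i> * z))) \<partial>disk_area) = ?I"
    using nn_integral_disk_area_quarter_turn [of G]
      nn_integral_disk_area_quarter_turn [of "\<lambda>z. G (\<i> * z)"]
      nn_integral_disk_area_quarter_turn [of "\<lambda>z. G (\<i> * (\<i> * z))"]
    by (simp_all add: G_def)
  have sum: "G z + G (\<i> * z) + G (\<i> * (\<i> * z)) + G (\<i> * (\<i> * (\<i> * z)))
      = ennreal (4 * (1 + 4 * (cmod z)\<^sup>2 + ((cmod z)\<^sup>2)\<^sup>2))" for z
  proof -
    have "cmod (1 + z) ^ 4 + cmod (1 + \<i> * z) ^ 4 + cmod (1 + \<i> * (\<i> * z)) ^ 4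
        + cmod (1 + \<i> * (\<i> * (\<i> * z))) ^ 4 = 4 * (1 + 4 * (cmod z)\<^sup>2 + ((cmod z)\<^sup>2)\<^sup>2)"
      unfolding cmod_power4 cmod_power2 by (simp add: algebra_simps power2_eq_square)
    then show ?thesis
      unfolding G_def by (simp flip: ennreal_plus)
  qed
  have "4 * ?I = ?I + ?I + ?I + ?I"
    using distrib_right [of 2 2 ?I] by (simp add: mult_2 add.assoc)
  also have "\<dots> = (\<integral>\<^sup>+ z. G z + G (\<i> * z) + G (\<i> * (\<i> * z)) + G (\<i> * (\<i> * (\<i> * z))) \<partial>disk_area)"
    by (simp only: nn_integral_add borel_measurable_add meas turns)
  also have "\<dots> = (\<integral>\<^sup>+ t. ennreal (4 * (1 + 4 * t + t\<^sup>2)) * indicator {0..1} t \<partial>lborel)"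
    unfolding sum
    by (subst nn_integral_disk_area_radial [of "\<lambda>t. ennreal (4 * (1 + 4 * t + t\<^sup>2))", symmetric]) auto
  also have "\<dots> = ennreal (4 * (1 + 2 * 1\<^sup>2 + 1 ^ 3 / 3) - 4 * (0 + 2 * 0\<^sup>2 + 0 ^ 3 / 3))"
    by (rule nn_integral_FTC_Icc [where F = "\<lambda>t. 4 * (t + 2 * t\<^sup>2 + t ^ 3 / 3)"])
       (auto intro!: derivative_eq_intros)
  finally have "4 * ?I = ennreal (40 / 3)" by simp
  also have "\<dots> = 4 * ennreal (10 / 3)"
    by (simp add: ennreal_mult' [symmetric] flip: ennreal_numeral)
  finally show ?thesis
    by (simp add: ennreal_mult_cancel_left)
qed

text \<open>This derivative, valid also at \<open>0\<close>, provides an antiderivative of the integrand below on the whole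
  slice, without splitting it at the imaginary axis.\<close>

lemma has_real_derivative_mult_abs:
  "((\<lambda>x::real. x * \<bar>x\<bar>) has_real_derivative 2 * \<bar>x\<bar>) (at x)"
proof (cases "x = 0")
  case True
  show ?thesis
    unfolding True CARAT_DERIV by (rule exI [of _ abs]) (auto)
next
  case False
  then consider "0 < x" | "x < 0" by linarith
  then show ?thesis
  proof cases
    case 1
    have "((\<lambda>x. x * x) has_real_derivative 2 * \<bar>x\<bar>) (at x)"
      using 1 by (auto intro!: derivative_eq_intros)
    then show ?thesis
      by (rule has_field_derivative_transform_within_open [where S = "{0<..}"]) (use 1 in auto)
  next
    case 2
    have "((\<lambda>x. - (x * x)) has_real_derivative 2 * \<bar>x\<bar>) (at x)"
      using 2 by (auto intro!: derivative_eq_intros)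
    then show ?thesis
      by (rule has_field_derivative_transform_within_open [where S = "{..<0}"]) (use 2 in auto)
  qed
qed

text \<open>Integrating along \<open>x\<close> first keeps the computation polynomial: the half-width \<open>c = \<surd>(1 - y\<^sup>2)\<close> of the
  slice enters only through \<open>c\<^sup>2\<close>.\<close>

lemma nn_integral_horizontal_slice:
  fixes y :: real
  assumes "\<bar>y\<bar> \<le> 1"
  shows "(\<integral>\<^sup>+ x. ennreal (\<bar>x\<bar> * (1 + (x\<^sup>2 + y\<^sup>2))) * indicator (ball 0 1) (Complex x y) \<partial>lborel)
    = ennreal (3 / 2 - y\<^sup>2 - y ^ 4 / 2)"
proof -
  define c where "c = sqrt (1 - y\<^sup>2)"
  have c: "0 \<le> c" "c\<^sup>2 = 1 - y\<^sup>2"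
    using assms by (auto simp: c_def abs_square_le_1)
  have mem: "Complex x y \<in> ball 0 1 \<longleftrightarrow> -c < x \<and> x < c" for x
  proof -
    have "Complex x y \<in> ball 0 1 \<longleftrightarrow> x\<^sup>2 < c\<^sup>2"
      by (auto simp: cmod_def c)
    also have "\<dots> \<longleftrightarrow> \<bar>x\<bar> < c"
      using c(1) by (metis abs_of_nonneg real_sqrt_abs real_sqrt_less_iff)
    finally show ?thesis by auto
  qed
  have "(\<integral>\<^sup>+ x. ennreal (\<bar>x\<bar> * (1 + (x\<^sup>2 + y\<^sup>2))) * indicator (ball 0 1) (Complex x y) \<partial>lborel)
      = (\<integral>\<^sup>+ x. ennreal (\<bar>x\<bar> * (1 + (x\<^sup>2 + y\<^sup>2))) * indicator {-c..c} x \<partial>lborel)"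
    \<comment> \<open>The open and the closed slice differ by two points.\<close>
  proof (rule nn_integral_cong_AE)
    show "AE x in lborel. ennreal (\<bar>x\<bar> * (1 + (x\<^sup>2 + y\<^sup>2))) * indicator (ball 0 1) (Complex x y)
        = ennreal (\<bar>x\<bar> * (1 + (x\<^sup>2 + y\<^sup>2))) * indicator {-c..c} x"
      using AE_lborel_singleton [of c] AE_lborel_singleton [of "-c"]
      by eventually_elim (auto simp: indicator_def mem simp del: mem_ball mem_ball_0)
  qed
  also have "\<dots> = ennreal (c * \<bar>c\<bar> * ((1 + y\<^sup>2) / 2 + c\<^sup>2 / 4)
      - (- c) * \<bar>- c\<bar> * ((1 + y\<^sup>2) / 2 + (- c)\<^sup>2 / 4))"
  proof (rule nn_integral_FTC_Icc [where F = "\<lambda>x. x * \<bar>x\<bar> * ((1 + y\<^sup>2) / 2 + x\<^sup>2 / 4)"])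
    fix x :: real
    have "((\<lambda>x. (1 + y\<^sup>2) / 2 + x\<^sup>2 / 4) has_real_derivative x / 2) (at x)"
      by (auto intro!: derivative_eq_intros)
    then show "((\<lambda>x. x * \<bar>x\<bar> * ((1 + y\<^sup>2) / 2 + x\<^sup>2 / 4)) has_real_derivative
        \<bar>x\<bar> * (1 + (x\<^sup>2 + y\<^sup>2))) (at x)"
      by (rule DERIV_cong [OF DERIV_mult [OF has_real_derivative_mult_abs]])
         (simp add: algebra_simps add_divide_distrib power2_eq_square)
  qed (use c(1) in auto)
  also have "c * \<bar>c\<bar> * ((1 + y\<^sup>2) / 2 + c\<^sup>2 / 4) - (- c) * \<bar>- c\<bar> * ((1 + y\<^sup>2) / 2 + (- c)\<^sup>2 / 4)
      = c\<^sup>2 * (1 + y\<^sup>2) + (c\<^sup>2)\<^sup>2 / 2"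
    using c(1) by (simp add: field_simps power2_eq_square)
  also have "\<dots> = 3 / 2 - y\<^sup>2 - y ^ 4 / 2"
    unfolding c(2) by (simp add: field_simps power2_eq_square power4_eq_xxxx)
  finally show ?thesis .
qed

lemma nn_integral_abs_Re:
  "(\<integral>\<^sup>+ z. ennreal (\<bar>Re z\<bar> * (1 + (cmod z)\<^sup>2)) \<partial>disk_area) = ennreal (32 / (15 * pi))"
proof -
  have "(\<integral>\<^sup>+ z. ennreal (\<bar>Re z\<bar> * (1 + (cmod z)\<^sup>2)) * indicator (ball 0 1) z \<partial>lborel)
      = (\<integral>\<^sup>+ y. \<integral>\<^sup>+ x. ennreal (\<bar>x\<bar> * (1 + (x\<^sup>2 + y\<^sup>2))) * indicator (ball 0 1) (Complex x y)
          \<partial>lborel \<partial>lborel)"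
    by (subst nn_integral_lborel_complex)
       (auto simp: cmod_power2 intro!: borel_measurable_times_ennreal borel_measurable_indicator)
  also have "\<dots> = (\<integral>\<^sup>+ y. ennreal (3 / 2 - y\<^sup>2 - y ^ 4 / 2) * indicator {-1..1} y \<partial>lborel)"
  proof (intro nn_integral_cong)
    fix y :: real
    show "(\<integral>\<^sup>+ x. ennreal (\<bar>x\<bar> * (1 + (x\<^sup>2 + y\<^sup>2))) * indicator (ball 0 1) (Complex x y) \<partial>lborel)
        = ennreal (3 / 2 - y\<^sup>2 - y ^ 4 / 2) * indicator {-1..1} y"
    proof (cases "\<bar>y\<bar> \<le> 1")
      case True
      then show ?thesis by (simp add: nn_integral_horizontal_slice abs_le_iff)
    next
      case False
      then have "Complex x y \<notin> ball 0 1" for x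
        using abs_Im_le_cmod [of "Complex x y"] by simp
      with False show ?thesis by (auto simp: indicator_def)
    qed
  qed
  also have "\<dots> = ennreal ((3 / 2 * 1 - 1 ^ 3 / 3 - 1 ^ 5 / 10)
      - (3 / 2 * (- 1) - (- 1) ^ 3 / 3 - (- 1) ^ 5 / 10))"
  proof (rule nn_integral_FTC_Icc [where F = "\<lambda>y. 3 / 2 * y - y ^ 3 / 3 - y ^ 5 / 10"])
    fix y :: real assume "y \<in> {-1..1}"
    then have "y\<^sup>2 \<le> 1" by (simp add: abs_square_le_1 abs_le_iff)
    moreover from this have "(y\<^sup>2)\<^sup>2 \<le> 1" by (rule power_le_one [rotated]) simp
    then have "y ^ 4 \<le> 1" by simp
    ultimately show "0 \<le> 3 / 2 - y\<^sup>2 - y ^ 4 / 2" by simp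
  qed (auto intro!: derivative_eq_intros)
  finally show ?thesis
    by (subst nn_integral_disk_area) (simp_all add: field_simps flip: ennreal_mult)
qed

section \<open>Failure of the triangle inequality\<close>

lemma bergman_norm_finite:
  assumes "(\<integral>\<^sup>+ z. ennreal (cmod (f z) powr p) \<partial>disk_area) = ennreal c" "0 \<le> c"
  shows "bergman_norm p f = ennreal (c powr (1 / p))"
  using assms by (simp add: bergman_norm_def)

text \<open>A bound from below also has to cover an infinite integral, for which the norm is infinite by
  convention.\<close>

lemma bergman_norm_gt:
  assumes "ennreal c \<le> (\<integral>\<^sup>+ z. ennreal (cmod (f z) powr p) \<partial>disk_area)" "0 \<le> b" "b < c" "0 < p"
  shows "ennreal (b powr (1 / p)) < bergman_norm p f"
proof (cases "(\<integral>\<^sup>+ z. ennreal (cmod (f z) powr p) \<partial>disk_area)")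
  case (real I)
  then have "b < I" using assms by (simp add: ennreal_le_iff2)
  with real assms show ?thesis
    by (simp add: bergman_norm_def ennreal_less_iff powr_less_mono2)
qed (simp add: bergman_norm_def)

theorem theorem7:
  fixes p :: real and f g :: "complex \<Rightarrow> complex"
  assumes "0 < p" and "p < 1 / 2"
    and "\<And>z. z \<in> ball 0 1 \<Longrightarrow> f z = (1 + z) powr complex_of_real (4 / p)"
    and "\<And>z. z \<in> ball 0 1 \<Longrightarrow> g z = - f (- z)"
  shows "(\<forall>z \<in> ball 0 1. g z = - ((1 - z) powr complex_of_real (4 / p))) \<and>
         f \<in> bergman_space p \<and> g \<in> bergman_space p \<and>
         bergman_norm p (\<lambda>z. f z + g z) > bergman_norm p f + bergman_norm p g"
proof -
  note f = assms(3)
  have g: "g z = - ((1 - z) powr complex_of_real (4 / p))" if "z \<in> ball 0 1" for z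
    using assms(4) [OF that] f [of "- z"] that by simp
  have f_mod: "cmod (f z) powr p = cmod (1 + z) ^ 4"
    and g_mod: "cmod (g z) powr p = cmod (1 - z) ^ 4" if "z \<in> ball 0 1" for z
    using that \<open>0 < p\<close> by (simp_all only: f g norm_minus_cancel cmod_powr_powr) simp_all
  have If: "(\<integral>\<^sup>+ z. ennreal (cmod (f z) powr p) \<partial>disk_area) = ennreal (10 / 3)"
    unfolding nn_integral_fourth_power_one_plus [symmetric]
    by (intro nn_integral_cong) (simp add: space_disk_area f_mod)
  \<comment> \<open>The reflection \<open>z \<mapsto> - z\<close> is two quarter turns, so \<open>|1 - z|\<^sup>4\<close> has the same integral as \<open>|1 + z|\<^sup>4\<close>.\<close>
  have "(\<integral>\<^sup>+ z. ennreal (cmod (g z) powr p) \<partial>disk_area)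
      = (\<integral>\<^sup>+ z. ennreal (cmod (1 + \<i> * (\<i> * z)) ^ 4) \<partial>disk_area)"
    by (intro nn_integral_cong) (simp add: space_disk_area g_mod flip: mult.assoc)
  also have "\<dots> = ennreal (10 / 3)"
    using nn_integral_disk_area_quarter_turn [of "\<lambda>z. ennreal (cmod (1 + z) ^ 4)"]
      nn_integral_disk_area_quarter_turn [of "\<lambda>z. ennreal (cmod (1 + \<i> * z) ^ 4)"]
    by (simp add: nn_integral_fourth_power_one_plus)
  finally have Ig: "(\<integral>\<^sup>+ z. ennreal (cmod (g z) powr p) \<partial>disk_area) = ennreal (10 / 3)" .
  have norm_f: "bergman_norm p f = ennreal ((10 / 3) powr (1 / p))"
    and norm_g: "bergman_norm p g = ennreal ((10 / 3) powr (1 / p))"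
    using bergman_norm_finite [OF If] bergman_norm_finite [OF Ig] by simp_all
  have nonpos: "1 + z \<notin> \<real>\<^sub>\<le>\<^sub>0" if "z \<in> ball 0 1" for z :: complex
    using that abs_Re_le_cmod [of z] by (auto simp: complex_nonpos_Reals_iff)
  have "(\<lambda>z. (1 + z) powr complex_of_real (4 / p)) holomorphic_on ball 0 1"
    using nonpos by (intro holomorphic_intros) auto
  then have "f holomorphic_on ball 0 1"
    by (rule holomorphic_transform) (simp add: f)
  moreover have "(\<lambda>z. - ((1 - z) powr complex_of_real (4 / p))) holomorphic_on ball 0 1"
    using nonpos [of "- z" for z] by (intro holomorphic_intros) auto
  then have "g holomorphic_on ball 0 1"
    by (rule holomorphic_transform) (simp add: g)
  ultimately have mem: "f \<in> bergman_space p" "g \<in> bergman_space p"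
    by (simp_all add: bergman_space_def norm_f norm_g)
  have "ennreal (256 / (15 * pi))
      = 8 * (\<integral>\<^sup>+ z. ennreal (\<bar>Re z\<bar> * (1 + (cmod z)\<^sup>2)) \<partial>disk_area)"
    unfolding nn_integral_abs_Re by (simp add: ennreal_mult' [symmetric] flip: ennreal_numeral)
  also have "\<dots> = (\<integral>\<^sup>+ z. 8 * ennreal (\<bar>Re z\<bar> * (1 + (cmod z)\<^sup>2)) \<partial>disk_area)"
    by (subst nn_integral_cmult) (auto intro: borel_measurable_disk_area)
  also have "\<dots> \<le> (\<integral>\<^sup>+ z. ennreal (cmod (f z + g z) powr p) \<partial>disk_area)"
  proof (intro nn_integral_mono)
    fix z assume "z \<in> space disk_area"
    then have z: "z \<in> ball 0 1" by (simp add: space_disk_area)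
    have "8 * (\<bar>Re z\<bar> * (1 + (cmod z)\<^sup>2)) = \<bar>8 * (Re z * (1 + (cmod z)\<^sup>2))\<bar>"
      by (simp add: abs_mult)
    also have "\<dots> = \<bar>cmod (f z) powr p - cmod (- g z) powr p\<bar>"
      by (simp only: norm_minus_cancel f_mod [OF z] g_mod [OF z] fourth_power_difference)
    also have "\<dots> \<le> cmod (f z + g z) powr p"
      using norm_powr_diff_le [of p "f z" "- g z"] assms(1,2) by simp
    finally show "8 * ennreal (\<bar>Re z\<bar> * (1 + (cmod z)\<^sup>2)) \<le> ennreal (cmod (f z + g z) powr p)"
      by (simp add: ennreal_leI ennreal_mult' [symmetric] flip: ennreal_numeral)
  qed
  finally have lower: "ennreal (256 / (15 * pi))
      \<le> (\<integral>\<^sup>+ z. ennreal (cmod (f z + g z) powr p) \<partial>disk_area)" .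
  have "2 powr p * (10 / 3) < 256 / (15 * pi)"
  proof -
    have "2 powr p \<le> 2 powr (1 / 2)" using assms by (intro powr_mono) auto
    also have "\<dots> < 3 / 2"
      by (simp only: powr_half_sqrt) (rule real_less_lsqrt; simp add: power2_eq_square)
    finally have "2 powr p * (10 / 3) < 5" by simp
    also have "5 < 256 / (15 * pi)" using pi_approx by (simp add: field_simps)
    finally show ?thesis .
  qed
  then have "ennreal ((2 powr p * (10 / 3)) powr (1 / p)) < bergman_norm p (\<lambda>z. f z + g z)"
    using assms by (intro bergman_norm_gt [OF lower]) auto
  moreover have "(2 powr p * (10 / 3)) powr (1 / p) = (10 / 3) powr (1 / p) + (10 / 3) powr (1 / p)"
    using assms by (subst powr_mult) (auto simp: powr_powr)
  ultimately have "bergman_norm p f + bergman_norm p g < bergman_norm p (\<lambda>z. f z + g z)"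
    by (simp add: norm_f norm_g flip: ennreal_plus)
  with g mem show ?thesis by blast
qed

end
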